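(* Let $G$ be a connected graph of order $n$. Then $sdiam_3(G)=3$ if and only if all of the following hold: (1) $\Delta(\overline{G})\geq 2$; (2) $\overline{G}$ does not contain a triple-star of order $n$ as a subgraph; (3) $\overline{G}$ does not contain a graph of type $H_2$ of order $n$ as a subgraph.
   Context: All graphs are finite, simple and undirected; $\overline{G}$ is the complement of $G$ and $\Delta$ the maximum degree. For $S\subseteq V(G)$ with $|S|\geq 2$, the Steiner distance $d_G(S)$ is the minimum number of edges of a tree in $G$ whose vertex set contains $S$ ($\infty$ if none exists), and $sdiam_k(G)$ is the maximum of $d_G(S)$ over all $S\subseteq V(G)$ with $|S|=k$. A triple-star of order $n$ is a graph obtained from a triangle on vertices $u,v,w$ and three stars $K_{1,a},K_{1,b},K_{1,c}$ by identifying the center of each star with a distinct vertex of the triangle, where $0\leq a\leq b\leq c$, $c\geq 1$ and $a+b+c=n-3$ (so $u,v,w$ receive $a,b,c$ pendant neighbours respectively). A graph of type $H_2$ of order $n$ is a graph on vertex set $\{u,v,w\}\cup X$ with $|X|=n-3$, containing the path $uvw$ (edges $uv,vw$), such that for each $x\in X$ the set of neighbours of $x$ in $\{u,v,w\}$ is exactly one of $\{u,v,w\}$, $\{u,v\}$, $\{v,w\}$, $\{u,w\}$, $\{v\}$. *)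

theory Defs
  imports "Graph_Theory.Digraph_Component" "HOL-Library.Extended_Nat"
begin

text \<open>
  A finite simple undirected graph is a \<^locale>\<open>pair_graph\<close>: a finite vertex set with a symmetric
  irreflexive set of arcs, so every edge is present as two opposite arcs.
\<close>

definition uedges :: "'a pair_pre_digraph \<Rightarrow> 'a set set" where
  "uedges G = (\<lambda>(x, y). {x, y}) ` parcs G"

text \<open>
  The library's \<^const>\<open>tree\<close> cannot be used here: for a symmetric digraph it counts the closed walk
  along an edge and back as a cycle. Cycles of an undirected graph have length at least three.
\<close>

definition utree :: "'a pair_pre_digraph \<Rightarrow> bool" where
  "utree T \<longleftrightarrow> pair_graph T \<and> connected (with_proj T) \<and>
     \<not> (\<exists>p. pre_digraph.cycle (with_proj T) p \<and> length p \<ge> 3)"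

text \<open>The infimum in \<^typ>\<open>enat\<close> is the minimum if a suitable tree exists and infinity otherwise.\<close>

definition steiner_dist :: "'a pair_pre_digraph \<Rightarrow> 'a set \<Rightarrow> enat" where
  "steiner_dist G S =
     (INF T \<in> {T. utree T \<and> subgraph (with_proj T) (with_proj G) \<and> S \<subseteq> pverts T}.
        enat (card (uedges T)))"

text \<open>
  For a finite graph the supremum is taken over finitely many sets, so it is the maximum. If the
  graph has fewer than \<open>k\<close> vertices, there is no such set and the value is \<open>0\<close>.
\<close>

definition sdiam :: "nat \<Rightarrow> 'a pair_pre_digraph \<Rightarrow> enat" where
  "sdiam k G = (SUP S \<in> {S. S \<subseteq> pverts G \<and> card S = k}. steiner_dist G S)"

definition complement_graph :: "'a pair_pre_digraph \<Rightarrow> 'a pair_pre_digraph" where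
  "complement_graph G = \<lparr> pverts = pverts G,
     parcs = {(x, y). x \<in> pverts G \<and> y \<in> pverts G \<and> x \<noteq> y \<and> (x, y) \<notin> parcs G} \<rparr>"

lemma pair_graph_complement_graph:
  assumes "pair_graph G"
  shows "pair_graph (complement_graph G)"
proof -
  interpret pair_graph G by fact
  have "parcs (complement_graph G) \<subseteq> pverts G \<times> pverts G"
    by (auto simp: complement_graph_def)
  then have "finite (parcs (complement_graph G))"
    using pair_finite_verts by (meson finite_SigmaI finite_subset)
  then show ?thesis
    using pair_finite_verts
    by unfold_locales
      (auto simp: complement_graph_def symmetric_def sym_def dest: arcs_symmetric)
qed

text \<open>In a symmetric loop-free digraph the degree of a vertex is its out-degree.\<close>

definition max_degree :: "'a pair_pre_digraph \<Rightarrow> nat" where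
  "max_degree G = Max (out_degree (with_proj G) ` pverts G)"

text \<open>
  \<open>A\<close>, \<open>B\<close>, \<open>C\<close> are the sets of leaves of the stars centred at \<open>u\<close>, \<open>v\<close>, \<open>w\<close>; their cardinalities
  are the parameters \<open>a \<le> b \<le> c\<close> of the triple-star.
\<close>

definition triple_star :: "nat \<Rightarrow> 'a pair_pre_digraph \<Rightarrow> bool" where
  "triple_star n H \<longleftrightarrow> (\<exists>u v w A B C.
     distinct [u, v, w] \<and> finite A \<and> finite B \<and> finite C \<and>
     {u, v, w} \<inter> (A \<union> B \<union> C) = {} \<and> A \<inter> B = {} \<and> A \<inter> C = {} \<and> B \<inter> C = {} \<and>
     card A \<le> card B \<and> card B \<le> card C \<and> card C \<ge> 1 \<and> card A + card B + card C + 3 = n \<and>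
     pverts H = {u, v, w} \<union> A \<union> B \<union> C \<and>
     (let E = {(u, v), (v, w), (u, w)} \<union> {u} \<times> A \<union> {v} \<times> B \<union> {w} \<times> C
      in parcs H = E \<union> E\<inverse>))"

text \<open>Adjacency within \<open>X\<close> and between \<open>u\<close> and \<open>w\<close> is unconstrained.\<close>

definition type_H2 :: "nat \<Rightarrow> 'a pair_pre_digraph \<Rightarrow> bool" where
  "type_H2 n H \<longleftrightarrow> pair_graph H \<and> (\<exists>u v w X.
     distinct [u, v, w] \<and> {u, v, w} \<inter> X = {} \<and> card X + 3 = n \<and>
     pverts H = {u, v, w} \<union> X \<and> (u, v) \<in> parcs H \<and> (v, w) \<in> parcs H \<and>
     (\<forall>x\<in>X. {y \<in> {u, v, w}. (x, y) \<in> parcs H} \<in> {{u, v, w}, {u, v}, {v, w}, {u, w}, {v}}))"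

end

(*
  A connected graph on m vertices has a spanning tree with m - 1 edges, so the Steiner distance of S
  is at most k iff S lies in a set of at most k + 1 vertices inducing a connected subgraph. Hence
  sdiam_3 > 2 iff some triple spans at most one edge, i.e. the complement has two incident edges,
  and sdiam_3 > 3 iff some triple S stays disconnected after adding any further vertex. If S spans
  no edge of G, this says that every other vertex is adjacent in the complement to a member of S (a
  triple-star); if S spans exactly the edge uw, every other vertex is adjacent in the complement to
  v or to both u and w (type H2).
*)
theory Submission
  imports Defs
begin

section \<open>Connectedness by cuts\<close>

text \<open>Connectedness of the subgraph induced on \<open>W\<close>, expressed by cuts: no walks are needed to
  grow a spanning tree or to exhibit a disconnected set.\<close>

definition linked :: "('a \<times> 'a) set \<Rightarrow> 'a set \<Rightarrow> bool" where
  "linked E W \<longleftrightarrow> W \<noteq> {} \<and>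
     (\<forall>A. A \<noteq> {} \<and> A \<subset> W \<longrightarrow> (\<exists>a\<in>A. \<exists>b\<in>W - A. (a, b) \<in> E))"

lemma linked_cut:
  assumes "linked E W" "A \<noteq> {}" "A \<subset> W"
  obtains a b where "a \<in> A" "b \<in> W" "b \<notin> A" "(a, b) \<in> E"
  using assms unfolding linked_def by blast

lemma not_linked:
  assumes "A \<noteq> {}" "A \<subset> W" "\<And>a b. a \<in> A \<Longrightarrow> b \<in> W - A \<Longrightarrow> (a, b) \<notin> E"
  shows "\<not> linked E W"
  using assms unfolding linked_def by blast

lemma linked_mono: "linked E W \<Longrightarrow> E \<subseteq> F \<Longrightarrow> linked F W"
  unfolding linked_def by blast

lemma linked_singleton: "linked E {x}"
  unfolding linked_def by auto

text \<open>A cut of the enlarged set separates \<open>x\<close> from all of \<open>W\<close> or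
  splits \<open>W\<close>. The edge between \<open>y\<close> and \<open>x\<close> crosses a cut of
  the first kind, in whichever direction is required; the connectedness of \<open>W\<close> handles
  the second.\<close>

lemma linked_insert:
  assumes "linked E W" "sym E" "y \<in> W" "(y, x) \<in> E"
  shows "linked E (insert x W)"
  unfolding linked_def
proof (intro conjI allI impI)
  fix A assume A: "A \<noteq> {} \<and> A \<subset> insert x W"
  have xy: "(x, y) \<in> E" using assms by (auto dest: symD)
  consider "A \<inter> W = {}" | "W \<subseteq> A" | "A \<inter> W \<noteq> {}" "A \<inter> W \<subset> W" by blast
  then show "\<exists>a\<in>A. \<exists>b\<in>insert x W - A. (a, b) \<in> E"
  proof cases
    case 1
    then have "x \<in> A" "y \<in> insert x W - A" using A assms(3) by auto
    then show ?thesis using xy by blast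
  next
    case 2
    then have "y \<in> A" "x \<in> insert x W - A" using A assms(3) by auto
    then show ?thesis using assms(4) by blast
  next
    case 3
    from linked_cut[OF assms(1) this] obtain a b where
      "a \<in> A \<inter> W" "b \<in> W" "b \<notin> A \<inter> W" "(a, b) \<in> E" .
    then show ?thesis by blast
  qed
qed simp

text \<open>A vertex set that no arc leaves contains everything reachable from its members, so
  reachability rules out such proper sets. Conversely, the set of vertices reachable from
  \<open>u\<close> is left by no arc and must be everything.\<close>

lemma connected_iff_linked:
  assumes "pair_graph G"
  shows "connected (with_proj G) \<longleftrightarrow> linked (parcs G) (pverts G)"
proof -
  interpret pair_graph G by fact
  have sym: "sym (parcs G)"
    using pair_sym_arcs by (auto simp: symmetric_def)
  have "connected (with_proj G) \<longleftrightarrow>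
      pverts G \<noteq> {} \<and> (\<forall>u\<in>pverts G. \<forall>v\<in>pverts G. (u, v) \<in> (parcs G)\<^sup>*)"
  proof -
    have "strongly_connected (with_proj G) \<longleftrightarrow>
        pverts G \<noteq> {} \<and> (\<forall>u\<in>pverts G. \<forall>v\<in>pverts G. (u, v) \<in> (parcs G)\<^sup>*)"
      unfolding strongly_connected_def by (auto simp: reachable_conv')
    \<comment> \<open>\<open>connected\<close> means strong connectedness of the symmetric closure,
      which here is the graph itself.\<close>
    moreover have "mk_symmetric (with_proj G) = G"
      using sym by (cases G) (auto simp: mk_symmetric_def dest: symD)
    ultimately show ?thesis
      by (simp add: connected_def)
  qed
  also have "\<dots> \<longleftrightarrow> linked (parcs G) (pverts G)"
  proof
    assume r: "pverts G \<noteq> {} \<and> (\<forall>u\<in>pverts G. \<forall>v\<in>pverts G. (u, v) \<in> (parcs G)\<^sup>*)"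
    show "linked (parcs G) (pverts G)"
      unfolding linked_def
    proof (intro conjI allI impI)
      fix A assume A: "A \<noteq> {} \<and> A \<subset> pverts G"
      then obtain a b where ab: "a \<in> A" "b \<in> pverts G" "b \<notin> A" by blast
      show "\<exists>a\<in>A. \<exists>b\<in>pverts G - A. (a, b) \<in> parcs G"
      proof (rule ccontr)
        assume n: "\<not> ?thesis"
        have "(a, b) \<in> (parcs G)\<^sup>*" using r ab A by blast
        then have "b \<in> A"
        proof induction
          case (step c d)
          then show ?case using n wellformed' by blast
        qed (use ab in simp)
        then show False using ab by simp
      qed
    qed (use r in simp)
  next
    assume l: "linked (parcs G) (pverts G)"
    have "(u, v) \<in> (parcs G)\<^sup>*" if uv: "u \<in> pverts G" "v \<in> pverts G" for u v
    proof (rule ccontr)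
      assume n: "(u, v) \<notin> (parcs G)\<^sup>*"
      let ?A = "{w \<in> pverts G. (u, w) \<in> (parcs G)\<^sup>*}"
      have "?A \<noteq> {}" "?A \<subset> pverts G" using uv n by auto
      from linked_cut[OF l this] obtain a b where
        "a \<in> ?A" "b \<in> pverts G" "b \<notin> ?A" "(a, b) \<in> parcs G" .
      then show False by (auto dest: rtrancl_into_rtrancl)
    qed
    then show "pverts G \<noteq> {} \<and> (\<forall>u\<in>pverts G. \<forall>v\<in>pverts G. (u, v) \<in> (parcs G)\<^sup>*)"
      using l by (auto simp: linked_def)
  qed
  finally show ?thesis .
qed

section \<open>Cycles and attaching leaves to trees\<close>

text \<open>Both lists are the vertices visited by the walk, read off the tails of its arcs on one
  side and off the heads on the other.\<close>

lemma pcas_shift: "pcas u p v \<Longrightarrow> map fst p @ [v] = u # map snd p"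
  by (induction p arbitrary: u) auto

lemma tl_pawalk_verts:
  assumes "pcas u p v"
  shows "tl (pawalk_verts u p) = map snd p"
proof -
  have "pcas u p v \<Longrightarrow> pawalk_verts u p = map fst p @ [v]"
    by (induction p arbitrary: u) auto
  then show ?thesis using assms by (simp add: pcas_shift)
qed

lemma rotate1_map_fst: "pcas u p u \<Longrightarrow> rotate1 (map fst p) = map snd p"
  using pcas_shift[of u p u] by (cases p) auto

definition add_leaf :: "'a pair_pre_digraph \<Rightarrow> 'a \<Rightarrow> 'a \<Rightarrow> 'a pair_pre_digraph" where
  "add_leaf T y x = \<lparr>pverts = insert x (pverts T), parcs = {(x, y), (y, x)} \<union> parcs T\<rparr>"

lemma add_leaf_simps [simp]:
  "pverts (add_leaf T y x) = insert x (pverts T)"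
  "parcs (add_leaf T y x) = {(x, y), (y, x)} \<union> parcs T"
  by (auto simp: add_leaf_def)

text \<open>After its first entry, the vertex list of a walk consists of the heads of its arcs, so
  the condition that a cycle repeats no vertex becomes distinctness of
  \<open>map snd p\<close>.\<close>

lemma cycle_with_proj_iff:
  "pre_digraph.cycle (with_proj G) p \<longleftrightarrow>
     set p \<subseteq> parcs G \<and> p \<noteq> [] \<and> distinct (map snd p) \<and> (\<exists>u\<in>pverts G. pcas u p u)"
  by (auto simp: pre_digraph.cycle_def pre_digraph.awalk_def cas_with_proj_eq
      awalk_verts_with_proj_eq tl_pawalk_verts)

text \<open>The growth step for spanning trees: the new vertex is joined to \<open>y\<close> only,
  so a cycle through it would have to enter and leave by the same edge, and any other cycle already
  lies in \<open>T\<close>.\<close>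

lemma utree_add_leaf:
  assumes T: "utree T" and y: "y \<in> pverts T" and x: "x \<notin> pverts T"
  shows "utree (add_leaf T y x)" (is "utree ?T")
proof -
  interpret T: pair_graph T using T by (simp add: utree_def)
  have neq: "x \<noteq> y" using x y by auto
  have symT: "sym (parcs T)"
    using T.pair_sym_arcs by (auto simp: symmetric_def)
  have pg: "pair_graph ?T"
    using x y neq symT T.pair_finite_verts T.pair_finite_arcs T.pair_no_loops
    by unfold_locales
      (auto simp: symmetric_def sym_def dest: T.wellformed')
  have "linked (parcs T) (pverts T)"
    using T connected_iff_linked by (auto simp: utree_def)
  then have "linked (parcs ?T) (pverts T)"
    by (rule linked_mono) auto
  moreover have "sym (parcs ?T)" using symT by (auto simp: sym_def)
  ultimately have "linked (parcs ?T) (pverts ?T)"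
    using linked_insert[of "parcs ?T" "pverts T" y x] y by simp
  then have conn: "connected (with_proj ?T)"
    using pg connected_iff_linked by blast
  have "\<not> pre_digraph.cycle (with_proj ?T) p" if len: "length p \<ge> 3" for p
  proof
    assume "pre_digraph.cycle (with_proj ?T) p"
    then obtain u where p: "set p \<subseteq> parcs ?T" "distinct (map snd p)" "pcas u p u" "p \<noteq> []"
      "u \<in> pverts ?T"
      by (auto simp: cycle_with_proj_iff)
    let ?L = "length p"
    have rot: "rotate1 (map fst p) = map snd p" using p(3) by (rule rotate1_map_fst)
    \<comment> \<open>On a closed walk the heads are the tails shifted cyclically by one, so tails
      are distinct too, and the arc after position \<open>i\<close> sits at
      \<open>Suc i mod ?L\<close>.\<close>
    then have dist: "distinct (map fst p)" using p(2) by (metis distinct1_rotate)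
    have sets: "set (map fst p) = set (map snd p)" using rot by (metis set_rotate1)
    have nxt: "snd (p ! i) = fst (p ! (Suc i mod ?L))" if "i < ?L" for i
    proof -
      have "rotate1 (map fst p) ! i = map fst p ! (Suc i mod ?L)"
        using that nth_rotate1[of i "map fst p"] by simp
      also have "\<dots> = fst (p ! (Suc i mod ?L))" using p(4) by simp
      finally show ?thesis using that rot by simp
    qed
    show False
    proof (cases "x \<in> set (map snd p)")
      case True
      \<comment> \<open>A cycle through the leaf contains \<open>(y, x), (x, y)\<close> consecutively, so \<open>y\<close> repeats.\<close>
      then obtain i where i: "i < ?L" "snd (p ! i) = x"
        by (auto simp: in_set_conv_nth)
      define j where "j = Suc i mod ?L"
      define k where "k = Suc j mod ?L"
      have jk: "j < ?L" "k < ?L" using p(4) by (simp_all add: j_def k_def)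
      have arc: "p ! m \<in> parcs ?T" if "m < ?L" for m
        using p(1) that nth_mem by blast
      have pi: "p ! i = (y, x)"
        using arc[OF i(1)] i(2) x neq by (cases "p ! i") (auto dest: T.wellformed')
      have "fst (p ! j) = x" using nxt[OF i(1)] i(2) by (simp add: j_def)
      then have pj: "p ! j = (x, y)"
        using arc[OF jk(1)] x neq by (cases "p ! j") (auto dest: T.wellformed')
      have "fst (p ! k) = fst (p ! i)" using nxt[OF jk(1)] pi pj by (simp add: k_def)
      then have "k = i" using dist i(1) jk(2) by (simp add: distinct_conv_nth) metis
      \<comment> \<open>\<open>k\<close> is \<open>i + 2\<close> modulo the length, which can equal
        \<open>i\<close> only for length 1 or 2; length 2 is the walk along an edge and back,
        excluded by \<open>len\<close>.\<close>
      moreover have "k \<noteq> i"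
        using len i(1) unfolding j_def k_def
        by (cases "Suc i = ?L"; cases "Suc (Suc i) = ?L") (auto)
      ultimately show False by simp
    next
      case False
      \<comment> \<open>Heads and tails of a closed walk form the same set, so a cycle for which
        \<open>x\<close> is no head does not use it as a tail either.\<close>
      then have "p ! m \<noteq> (x, y) \<and> p ! m \<noteq> (y, x)" if "m < ?L" for m
        using sets that by (metis fst_conv snd_conv in_set_conv_nth length_map nth_map)
      then have sub: "set p \<subseteq> parcs T"
        using p(1) by (fastforce simp: in_set_conv_nth)
      moreover have "u \<in> pverts T"
        using p(3,4) sub by (cases p) (auto dest: T.arc_fst_in_verts)
      ultimately have "pre_digraph.cycle (with_proj T) p"
        using p by (auto simp: cycle_with_proj_iff)
      then show False using T len by (auto simp: utree_def)
    qed
  qed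
  then show ?thesis using pg conn by (auto simp: utree_def)
qed

lemma card_uedges_add_leaf:
  assumes "pair_graph T" "x \<notin> pverts T"
  shows "card (uedges (add_leaf T y x)) = Suc (card (uedges T))"
proof -
  interpret T: pair_graph T by fact
  have "uedges (add_leaf T y x) = insert {x, y} (uedges T)"
    by (auto simp: uedges_def)
  moreover have "{x, y} \<notin> uedges T"
    using assms(2) by (auto simp: uedges_def doubleton_eq_iff dest: T.wellformed')
  moreover have "finite (uedges T)" using T.pair_finite_arcs by (simp add: uedges_def)
  ultimately show ?thesis by simp
qed

lemma utree_singleton: "utree \<lparr>pverts = {x}, parcs = {}\<rparr>"
proof -
  let ?T = "\<lparr>pverts = {x}, parcs = {}\<rparr> :: 'a pair_pre_digraph"
  have pg: "pair_graph ?T" by unfold_locales (auto simp: symmetric_def sym_def)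
  moreover have "connected (with_proj ?T)"
    using connected_iff_linked[OF pg] by (simp add: linked_singleton)
  ultimately show ?thesis by (auto simp: utree_def cycle_with_proj_iff)
qed

section \<open>Spanning trees and Steiner distance\<close>

text \<open>Grow a tree from a single vertex: as long as it misses part of \<open>W\<close>, some
  arc crosses the cut given by its vertex set, and the far end of that arc is attached as a leaf.
  Each step adds one vertex and one edge.\<close>

lemma linked_spanning_utree:
  assumes E: "linked E W" "sym E" and fin: "finite W"
  obtains T where "utree T" "pverts T = W" "parcs T \<subseteq> E" "card (uedges T) + 1 = card W"
proof -
  have "\<exists>T. utree T \<and> pverts T \<subseteq> W \<and> parcs T \<subseteq> E \<and> card (pverts T) = Suc k \<and> card (uedges T) = k"
    if "k < card W" for k
    using that
  proof (induction k)
    case 0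
    obtain x where "x \<in> W" using E by (auto simp: linked_def)
    then show ?case
      by (intro exI[of _ "\<lparr>pverts = {x}, parcs = {}\<rparr>"]) (auto simp: utree_singleton uedges_def)
  next
    case (Suc k)
    then obtain T where T: "utree T" "pverts T \<subseteq> W" "parcs T \<subseteq> E"
      "card (pverts T) = Suc k" "card (uedges T) = k"
      by auto
    have "pverts T \<noteq> {}" "pverts T \<subset> W" using T Suc.prems by auto
    from linked_cut[OF E(1) this] obtain y x where
      xy: "y \<in> pverts T" "x \<in> W" "x \<notin> pverts T" "(y, x) \<in> E" .
    have "pair_graph T" using T by (simp add: utree_def)
    moreover have "finite (pverts T)" using T fin finite_subset by blast
    ultimately show ?case
      using T xy E(2)
      by (intro exI[of _ "add_leaf T y x"])
        (auto simp: utree_add_leaf card_uedges_add_leaf dest: symD)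
  qed
  \<comment> \<open>Positivity permits \<open>k = card W - 1\<close>, where the tree has as many
    vertices as \<open>W\<close> and therefore spans it.\<close>
  moreover have "card W > 0" using E fin by (auto simp: linked_def card_gt_0_iff)
  ultimately obtain T where "utree T" "pverts T \<subseteq> W" "parcs T \<subseteq> E"
    "card (pverts T) = card W" "card (uedges T) = card W - 1"
    by (metis Suc_diff_1 diff_less zero_less_one)
  then show ?thesis
    using that \<open>card W > 0\<close> card_subset_eq[OF fin] by auto
qed

text \<open>A vertex set connected in \<open>G\<close> has a spanning tree with one edge fewer than
  vertices, hence \<open>Suc k\<close>; conversely the vertex set of a Steiner tree serves as
  \<open>W\<close>.\<close>

lemma steiner_dist_le_iff:
  assumes "pair_graph G"
  shows "steiner_dist G S \<le> enat k \<longleftrightarrow>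
    (\<exists>W. S \<subseteq> W \<and> W \<subseteq> pverts G \<and> card W \<le> Suc k \<and> linked (parcs G) W)"
    (is "?L \<longleftrightarrow> ?R")
proof
  interpret pair_graph G by fact
  assume ?L
  \<comment> \<open>\<open>INF_less_iff\<close> extracts a tree from a strict bound, so the bound is
    first raised by one.\<close>
  then have "steiner_dist G S < enat (Suc k)"
    by (metis enat_ord_simps(2) le_less_trans lessI)
  then obtain T where T: "utree T" "subgraph (with_proj T) (with_proj G)" "S \<subseteq> pverts T"
    "card (uedges T) \<le> k"
    unfolding steiner_dist_def by (auto simp: INF_less_iff)
  interpret T: pair_graph T using T by (simp add: utree_def)
  have l: "linked (parcs T) (pverts T)"
    using T(1) connected_iff_linked by (auto simp: utree_def)
  moreover have "sym (parcs T)" using T.pair_sym_arcs by (auto simp: symmetric_def)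
  \<comment> \<open>The vertices of \<open>T\<close> are counted through a spanning tree
    \<open>T'\<close> of it, whose edge count is known exactly and is at most that of
    \<open>T\<close>.\<close>
  ultimately obtain T' where T': "utree T'" "pverts T' = pverts T" "parcs T' \<subseteq> parcs T"
    "card (uedges T') + 1 = card (pverts T)"
    using T.pair_finite_verts by (rule linked_spanning_utree)
  have "card (uedges T') \<le> card (uedges T)"
    using T'(3) T.pair_finite_arcs unfolding uedges_def by (intro card_mono) auto
  then have "card (pverts T) \<le> Suc k" using T T' by simp
  moreover have "linked (parcs G) (pverts T)" "pverts T \<subseteq> pverts G"
    using l T(2) by (auto simp: subgraph_def intro: linked_mono)
  ultimately show ?R using T(3) by blast
next
  interpret pair_graph G by fact
  assume ?R
  then obtain W where W: "S \<subseteq> W" "W \<subseteq> pverts G" "card W \<le> Suc k" "linked (parcs G) W"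
    by blast
  have "finite W" using W pair_finite_verts finite_subset by blast
  have "sym (parcs G)" using pair_sym_arcs by (auto simp: symmetric_def)
  from linked_spanning_utree[OF W(4) this \<open>finite W\<close>] obtain T where T: "utree T" "pverts T = W" "parcs T \<subseteq> parcs G"
    "card (uedges T) + 1 = card W" .
  interpret T: pair_graph T using T by (simp add: utree_def)
  have "subgraph (with_proj T) (with_proj G)"
    using T W T.wf_digraph_axioms wf_digraph_axioms
    by (auto simp: subgraph_def compatible_def)
  then have "steiner_dist G S \<le> enat (card (uedges T))"
    unfolding steiner_dist_def using T W by (intro INF_lower) auto
  also have "\<dots> \<le> enat k" using T W by simp
  finally show ?L .
qed

lemma sdiam_le_iff:
  assumes "pair_graph G"
  shows "sdiam m G \<le> enat k \<longleftrightarrow> (\<forall>S. S \<subseteq> pverts G \<and> card S = m \<longrightarrow>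
    (\<exists>W. S \<subseteq> W \<and> W \<subseteq> pverts G \<and> card W \<le> Suc k \<and> linked (parcs G) W))"
  using steiner_dist_le_iff[OF assms] by (auto simp: sdiam_def SUP_le_iff)

section \<open>Connectedness of triples\<close>

text \<open>The singleton cuts force each vertex to meet one of the other two, which takes at least
  two of the three pairs. Any two pairs share a vertex, the middle of a path. Equality counts as
  adjacency, to cover coinciding vertices.\<close>

lemma linked_triple_iff:
  assumes "sym E"
  shows "linked E {u, v, w} \<longleftrightarrow> (u = v \<or> (u, v) \<in> E) \<and> (v = w \<or> (v, w) \<in> E) \<or>
    (u = v \<or> (u, v) \<in> E) \<and> (u = w \<or> (u, w) \<in> E) \<or>
    (u = w \<or> (u, w) \<in> E) \<and> (v = w \<or> (v, w) \<in> E)" (is "?L \<longleftrightarrow> ?R")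
proof -
  have comm: "(a, b) \<in> E \<longleftrightarrow> (b, a) \<in> E" for a b
    using assms by (auto dest: symD)
  have path: "linked E {a, b, c}" if "b = a \<or> (b, a) \<in> E" "b = c \<or> (b, c) \<in> E" for a b c
  proof -
    have "linked E {c, b}"
    proof (cases "b = c")
      case True
      then show ?thesis by (simp add: linked_singleton)
    next
      case False
      then have "(b, c) \<in> E" using that(2) by simp
      then show ?thesis by (rule linked_insert[OF linked_singleton assms singletonI])
    qed
    then have bc: "linked E {b, c}" by (simp add: insert_commute)
    show ?thesis
    proof (cases "b = a")
      case True
      then show ?thesis using bc by simp
    next
      case False
      then have "(b, a) \<in> E" using that(1) by simp
      then show ?thesis by (rule linked_insert[OF bc assms insertI1])
    qed
  qed
  show ?thesis
  proof
    assume l: ?L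
    \<comment> \<open>Stated for any listing of the triple, so that each vertex in turn can be the
      singleton cut \<open>{a}\<close>.\<close>
    have cut: "a = b \<or> a = c \<or> (a, b) \<in> E \<or> (a, c) \<in> E" if "{u, v, w} = {a, b, c}" for a b c
    proof (rule ccontr)
      assume "\<not> ?thesis"
      then have "\<not> linked E {a, b, c}" by (intro not_linked[of "{a}"]) auto
      then show False using l that by simp
    qed
    have "{u, v, w} = {v, u, w}" "{u, v, w} = {w, u, v}" by auto
    then show ?R
      using cut[of u v w] cut[of v u w] cut[of w u v] comm by metis
  next
    assume ?R
    moreover have "{u, v, w} = {v, u, w}" "{u, v, w} = {u, w, v}" by auto
    ultimately show ?L
      using path[where a = u and b = v and c = w] path[where a = v and b = u and c = w]
        path[where a = u and b = w and c = v] comm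
      by metis
  qed
qed

lemma superset_one_more:
  assumes "S \<subseteq> W" "finite W" "card W \<le> Suc (card S)"
  shows "W = S \<or> (\<exists>x. x \<notin> S \<and> W = insert x S)"
proof -
  have "card (W - S) \<le> 1"
    using assms by (simp add: card_Diff_subset finite_subset)
  then consider "card (W - S) = 0" | "card (W - S) = 1" by linarith
  then show ?thesis
  proof cases
    case 1
    then show ?thesis using assms by auto
  next
    case 2
    then obtain x where "W - S = {x}" by (auto simp: card_1_singleton_iff)
    then show ?thesis using assms(1) by blast
  qed
qed

section \<open>Spanning triple-stars\<close>

text \<open>\<open>triple_star\<close> demands sorted star sizes. The triangle is symmetric, so the
  three stars can be relabelled in order of size; this may reverse triangle arcs, which
  \<open>E \<union> E\<inverse>\<close> absorbs.\<close>

lemma triple_star_exists: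
  assumes uvw: "distinct [u, v, w]" and fin: "finite A" "finite B" "finite C"
    and disj: "{u, v, w} \<inter> (A \<union> B \<union> C) = {}" "A \<inter> B = {}" "A \<inter> C = {}" "B \<inter> C = {}"
    and ne: "A \<union> B \<union> C \<noteq> {}" and n: "card A + card B + card C + 3 = n"
    and E: "E = {(u, v), (v, w), (u, w)} \<union> {u} \<times> A \<union> {v} \<times> B \<union> {w} \<times> C"
  shows "triple_star n \<lparr>pverts = {u, v, w} \<union> A \<union> B \<union> C, parcs = E \<union> E\<inverse>\<rparr>"
proof -
  have ordered: "triple_star n \<lparr>pverts = {u, v, w} \<union> A \<union> B \<union> C, parcs = E \<union> E\<inverse>\<rparr>"
    if perm: "distinct [a, b, c]" "finite P" "finite Q" "finite R"
      "{a, b, c} \<inter> (P \<union> Q \<union> R) = {}" "P \<inter> Q = {}" "P \<inter> R = {}" "Q \<inter> R = {}"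
      "card P + card Q + card R + 3 = n"
      "{u, v, w} \<union> A \<union> B \<union> C = {a, b, c} \<union> P \<union> Q \<union> R"
      and arcs: "\<And>D. D = {(a, b), (b, c), (a, c)} \<union> {a} \<times> P \<union> {b} \<times> Q \<union> {c} \<times> R \<Longrightarrow>
        E \<union> E\<inverse> = D \<union> D\<inverse>"
      and le: "card P \<le> card Q" "card Q \<le> card R"
    for a b c :: 'a and P Q R
  proof -
    \<comment> \<open>Some star has a leaf, so the largest one has.\<close>
    have "card A + card B + card C > 0" using ne fin by (auto simp: card_gt_0_iff)
    then have "card R \<ge> 1" using le perm(9) n by linarith
    then show ?thesis
      unfolding triple_star_def Let_def
      by (intro exI[of _ a] exI[of _ b] exI[of _ c] exI[of _ P] exI[of _ Q] exI[of _ R] conjI)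
        (simp_all only: pair_pre_digraph.simps perm le arcs[OF refl])
  qed
  consider "card A \<le> card B" "card B \<le> card C" | "card A \<le> card C" "card C \<le> card B"
    | "card B \<le> card A" "card A \<le> card C" | "card B \<le> card C" "card C \<le> card A"
    | "card C \<le> card A" "card A \<le> card B" | "card C \<le> card B" "card B \<le> card A"
    by linarith
  then show ?thesis
  proof cases
    case 1
    then show ?thesis by (intro ordered[of u v w A B C]) (use assms in auto)
  next
    case 2
    then show ?thesis by (intro ordered[of u w v A C B]) (use assms in auto)
  next
    case 3
    then show ?thesis by (intro ordered[of v u w B A C]) (use assms in auto)
  next
    case 4
    then show ?thesis by (intro ordered[of v w u B C A]) (use assms in auto)
  next
    case 5
    then show ?thesis by (intro ordered[of w u v C A B]) (use assms in auto)
  next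
    case 6
    then show ?thesis by (intro ordered[of w v u C B A]) (use assms in auto)
  qed
qed

text \<open>Each vertex off the triangle becomes a leaf at the first of \<open>u\<close>,
  \<open>v\<close>, \<open>w\<close> adjacent to it, which partitions these vertices into three
  stars. Strict inclusion of the triangle supplies at least one leaf.\<close>

lemma spanning_triple_star:
  assumes G: "pair_graph G" and uvw: "distinct [u, v, w]" "{u, v, w} \<subset> pverts G"
    and tri: "(u, v) \<in> parcs G" "(v, w) \<in> parcs G" "(u, w) \<in> parcs G"
    and dom: "\<And>x. x \<in> pverts G - {u, v, w} \<Longrightarrow>
      (u, x) \<in> parcs G \<or> (v, x) \<in> parcs G \<or> (w, x) \<in> parcs G"
  shows "\<exists>H. triple_star (card (pverts G)) H \<and> subgraph (with_proj H) (with_proj G)"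
proof -
  interpret pair_graph G by fact
  define X where "X = pverts G - {u, v, w}"
  define A where "A = {x \<in> X. (u, x) \<in> parcs G}"
  define B where "B = {x \<in> X. (u, x) \<notin> parcs G \<and> (v, x) \<in> parcs G}"
  define C where "C = {x \<in> X. (u, x) \<notin> parcs G \<and> (v, x) \<notin> parcs G}"
  define E where "E = {(u, v), (v, w), (u, w)} \<union> {u} \<times> A \<union> {v} \<times> B \<union> {w} \<times> C"
  define H where "H = \<lparr>pverts = {u, v, w} \<union> A \<union> B \<union> C, parcs = E \<union> E\<inverse>\<rparr>"
  have X: "A \<union> B \<union> C = X" unfolding A_def B_def C_def by blast
  have fin: "finite X" unfolding X_def using pair_finite_verts by simp
  then have fins: "finite A" "finite B" "finite C" unfolding A_def B_def C_def by auto
  have disj: "A \<inter> B = {}" "A \<inter> C = {}" "B \<inter> C = {}" unfolding A_def B_def C_def by auto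
  have "card X + 3 = card (pverts G)"
    using uvw pair_finite_verts card_mono[of "pverts G" "{u, v, w}"]
    unfolding X_def by (subst card_Diff_subset) auto
  moreover have "card X = card A + card B + card C"
    using fins disj unfolding X[symmetric] by (simp add: card_Un_disjoint Int_Un_distrib2)
  ultimately have "triple_star (card (pverts G)) H"
    unfolding H_def
    by (intro triple_star_exists[OF uvw(1) fins _ disj _ _ E_def])
      (use uvw(2) X in \<open>auto simp: X_def\<close>)
  moreover have "subgraph (with_proj H) (with_proj G)"
  proof -
    have verts: "pverts H = pverts G" using X uvw(2) unfolding H_def X_def by auto
    have "E \<subseteq> parcs G"
      using tri dom unfolding E_def A_def B_def C_def X_def by auto
    then have arcs: "parcs H \<subseteq> parcs G"
      unfolding H_def by (auto intro: arcs_symmetric)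
    then have "pair_wf_digraph H"
      using verts arc_fst_in_verts arc_snd_in_verts by unfold_locales blast+
    then show ?thesis
      using verts arcs wf_digraph_axioms
      by (auto simp: subgraph_def compatible_def wf_digraph_wp_iff)
  qed
  ultimately show ?thesis by blast
qed

section \<open>Maximum degree\<close>

lemma max_degree_ge_iff:
  assumes "pair_graph G" "pverts G \<noteq> {}"
  shows "max_degree G \<ge> k \<longleftrightarrow> (\<exists>v\<in>pverts G. card {w. (v, w) \<in> parcs G} \<ge> k)"
proof -
  interpret pair_graph G by fact
  have "out_degree (with_proj G) v = card {w. (v, w) \<in> parcs G}" for v
  proof -
    have "out_arcs (with_proj G) v = Pair v ` {w. (v, w) \<in> parcs G}"
      by (auto simp: out_arcs_def)
    then show ?thesis by (simp add: out_degree_def card_image inj_on_def)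
  qed
  then show ?thesis
    using assms(2) pair_finite_verts by (auto simp: max_degree_def Max_ge_iff)
qed

lemma card_ge_2_iff:
  assumes "finite A"
  shows "card A \<ge> 2 \<longleftrightarrow> (\<exists>x\<in>A. \<exists>y\<in>A. x \<noteq> y)"
  using card_le_Suc0_iff_eq[OF assms] by (auto simp: not_less_eq_eq[symmetric] numeral_2_eq_2)

section \<open>The characterisation of Steiner 3-diameter 3\<close>

theorem theorem3:
  fixes G :: "'a pair_pre_digraph" and n :: nat
  assumes "pair_graph G"
    and "connected (with_proj G)"
    and "card (pverts G) = n"
  shows "sdiam 3 G = 3 \<longleftrightarrow>
    max_degree (complement_graph G) \<ge> 2 \<and>
    \<not> (\<exists>H. triple_star n H \<and> subgraph (with_proj H) (with_proj (complement_graph G))) \<and>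
    \<not> (\<exists>H. type_H2 n H \<and> subgraph (with_proj H) (with_proj (complement_graph G)))"
proof -
  interpret pair_graph G by fact
  let ?V = "pverts G" and ?E = "parcs G" and ?G' = "complement_graph G"
  let ?F = "parcs ?G'"
  interpret G': pair_graph ?G' by (rule pair_graph_complement_graph) fact
  have V': "pverts ?G' = ?V" by (simp add: complement_graph_def)
  have F: "(x, y) \<in> ?F \<longleftrightarrow> x \<in> ?V \<and> y \<in> ?V \<and> x \<noteq> y \<and> (x, y) \<notin> ?E" for x y
    by (auto simp: complement_graph_def)
  have symE: "sym ?E" using pair_sym_arcs by (auto simp: symmetric_def)
  then have E_comm: "(x, y) \<in> ?E \<longleftrightarrow> (y, x) \<in> ?E" for x y by (auto dest: symD)
  then have F_comm: "(x, y) \<in> ?F \<longleftrightarrow> (y, x) \<in> ?F" for x y by (auto simp: F)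
  have V: "linked ?E ?V" using assms connected_iff_linked by blast
  then have Vne: "?V \<noteq> {}" by (simp add: linked_def)

  \<comment> \<open>These are the triples of Steiner distance above 3: a tree with at most three
    edges has at most four vertices, so it spans the triple or one further vertex.\<close>
  define blocked where "blocked S \<longleftrightarrow> S \<subseteq> ?V \<and> card S = 3 \<and> \<not> linked ?E S \<and>
    (\<forall>x\<in>?V - S. \<not> linked ?E (insert x S))" for S

  have le2: "sdiam 3 G \<le> 2 \<longleftrightarrow> (\<forall>S. S \<subseteq> ?V \<and> card S = 3 \<longrightarrow> linked ?E S)"
  proof -
    have "sdiam 3 G \<le> enat 2 \<longleftrightarrow> (\<forall>S. S \<subseteq> ?V \<and> card S = 3 \<longrightarrow> linked ?E S)"
    proof -
      have "(\<exists>W. S \<subseteq> W \<and> W \<subseteq> ?V \<and> card W \<le> Suc 2 \<and> linked ?E W) \<longleftrightarrow> linked ?E S"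
        if S: "S \<subseteq> ?V" "card S = 3" for S
      proof -
        have "W = S" if "S \<subseteq> W" "W \<subseteq> ?V" "card W \<le> Suc 2" for W
          using that S card_seteq[of W S] finite_subset[OF _ pair_finite_verts, of W] by simp
        then show ?thesis using S by auto
      qed
      then show ?thesis unfolding sdiam_le_iff[OF assms(1)] by blast
    qed
    then show ?thesis by (simp add: numeral_eq_enat)
  qed
  have le3: "sdiam 3 G \<le> 3 \<longleftrightarrow> (\<nexists>S. blocked S)"
  proof -
    have "(\<exists>W. S \<subseteq> W \<and> W \<subseteq> ?V \<and> card W \<le> Suc 3 \<and> linked ?E W) \<longleftrightarrow>
        linked ?E S \<or> (\<exists>x\<in>?V - S. linked ?E (insert x S))"
      if S: "S \<subseteq> ?V" "card S = 3" for S
    proof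
      assume "\<exists>W. S \<subseteq> W \<and> W \<subseteq> ?V \<and> card W \<le> Suc 3 \<and> linked ?E W"
      then obtain W where W: "S \<subseteq> W" "W \<subseteq> ?V" "card W \<le> Suc 3" "linked ?E W" by blast
      moreover have "finite W" using W pair_finite_verts finite_subset by blast
      ultimately have "W = S \<or> (\<exists>x. x \<notin> S \<and> W = insert x S)"
        using superset_one_more[of S W] S by simp
      then show "linked ?E S \<or> (\<exists>x\<in>?V - S. linked ?E (insert x S))" using W by blast
    next
      have "finite S" using S by (simp add: card_ge_0_finite)
      then have c: "card (insert x S) \<le> Suc 3" for x using S by (simp add: card_insert_if)
      assume "linked ?E S \<or> (\<exists>x\<in>?V - S. linked ?E (insert x S))"
      then show "\<exists>W. S \<subseteq> W \<and> W \<subseteq> ?V \<and> card W \<le> Suc 3 \<and> linked ?E W"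
      proof (elim disjE bexE)
        assume "linked ?E S"
        then show ?thesis using S by (intro exI[of _ S]) simp
      next
        fix x assume "x \<in> ?V - S" "linked ?E (insert x S)"
        then show ?thesis using S c[of x] by (intro exI[of _ "insert x S"]) auto
      qed
    qed
    then have "sdiam 3 G \<le> enat 3 \<longleftrightarrow> (\<forall>S. S \<subseteq> ?V \<and> card S = 3 \<longrightarrow>
        linked ?E S \<or> (\<exists>x\<in>?V - S. linked ?E (insert x S)))"
      by (simp add: sdiam_le_iff[OF assms(1)])
    also have "\<dots> \<longleftrightarrow> (\<nexists>S. blocked S)"
      by (auto simp: blocked_def)
    finally show ?thesis by (simp add: numeral_eq_enat)
  qed
  \<comment> \<open>No extended natural number lies strictly between 2 and 3.\<close>
  have "sdiam 3 G = 3 \<longleftrightarrow> \<not> sdiam 3 G \<le> 2 \<and> sdiam 3 G \<le> 3"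
    by (cases "sdiam 3 G") (auto simp: numeral_eq_enat)

  \<comment> \<open>Disconnected triples and the degree in the complement\<close>
  moreover have "\<not> sdiam 3 G \<le> 2 \<longleftrightarrow> max_degree ?G' \<ge> 2"
  proof -
    have "max_degree ?G' \<ge> 2 \<longleftrightarrow> (\<exists>u v w. u \<noteq> w \<and> (v, u) \<in> ?F \<and> (v, w) \<in> ?F)"
    proof -
      have "finite {w. (v, w) \<in> ?F}" for v
        by (rule finite_subset[OF _ pair_finite_verts]) (auto simp: F)
      then have "max_degree ?G' \<ge> 2 \<longleftrightarrow> (\<exists>v\<in>?V. \<exists>u w. u \<noteq> w \<and> (v, u) \<in> ?F \<and> (v, w) \<in> ?F)"
        using max_degree_ge_iff[OF G'.pair_graph] Vne by (auto simp: V' card_ge_2_iff)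
      then show ?thesis by (auto simp: F)
    qed
    also have "\<dots> \<longleftrightarrow> (\<exists>S. S \<subseteq> ?V \<and> card S = 3 \<and> \<not> linked ?E S)"
    proof
      assume "\<exists>u v w. u \<noteq> w \<and> (v, u) \<in> ?F \<and> (v, w) \<in> ?F"
      then obtain u v w where "u \<noteq> w" "(v, u) \<in> ?F" "(v, w) \<in> ?F" by blast
      then have "{u, v, w} \<subseteq> ?V" "card {u, v, w} = 3" "\<not> linked ?E {u, v, w}"
        by (auto simp: F linked_triple_iff[OF symE] E_comm)
      then show "\<exists>S. S \<subseteq> ?V \<and> card S = 3 \<and> \<not> linked ?E S" by blast
    next
      assume "\<exists>S. S \<subseteq> ?V \<and> card S = 3 \<and> \<not> linked ?E S"
      then obtain u v w where "{u, v, w} \<subseteq> ?V" "distinct [u, v, w]" "\<not> linked ?E {u, v, w}"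
        by (auto simp: card_3_iff)
      then show "\<exists>u v w. u \<noteq> w \<and> (v, u) \<in> ?F \<and> (v, w) \<in> ?F"
        unfolding linked_triple_iff[OF symE] F using E_comm by auto metis+
    qed
    finally show ?thesis unfolding le2 by blast
  qed

  \<comment> \<open>Blocked triples and the two forbidden subgraphs\<close>
  moreover have "(\<exists>S. blocked S) \<longleftrightarrow>
    (\<exists>H. triple_star n H \<and> subgraph (with_proj H) (with_proj ?G')) \<or>
    (\<exists>H. type_H2 n H \<and> subgraph (with_proj H) (with_proj ?G'))"
  proof
    assume "\<exists>S. blocked S"
    then obtain S where S: "S \<subseteq> ?V" "card S = 3" "\<not> linked ?E S"
      "\<And>x. x \<in> ?V - S \<Longrightarrow> \<not> linked ?E (insert x S)"
      by (auto simp: blocked_def)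
    from S(2) obtain a b c where "S = {a, b, c}" "distinct [a, b, c]"
      by (auto simp: card_3_iff)
    moreover from this have "(a, b) \<notin> ?E \<and> (b, c) \<notin> ?E \<or> (a, b) \<notin> ?E \<and> (a, c) \<notin> ?E \<or>
        (a, c) \<notin> ?E \<and> (b, c) \<notin> ?E"
      using S(3) by (auto simp: linked_triple_iff[OF symE])
    moreover have "{a, b, c} = {b, a, c}" "{a, b, c} = {a, c, b}" by auto
    \<comment> \<open>Relabel so that \<open>v\<close> is the common end of two missing edges; then
      \<open>uw\<close> is the only possible edge of \<open>G\<close> inside the triple.\<close>
    ultimately obtain u v w where uvw: "S = {u, v, w}" "distinct [u, v, w]"
      "(u, v) \<notin> ?E" "(v, w) \<notin> ?E"
      using E_comm by (metis distinct_length_2_or_more)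
    have Fs: "(u, v) \<in> ?F" "(v, w) \<in> ?F" using uvw S by (auto simp: F)
    \<comment> \<open>Either \<open>xv\<close> is a complement edge, or at least two of the pairs
      \<open>xu\<close>, \<open>xw\<close>, \<open>uw\<close> are. Otherwise
      \<open>{x, u, w}\<close> is connected in \<open>G\<close> and \<open>v\<close> attaches to it
      through \<open>x\<close>, against blockedness.\<close>
    have near: "(x, v) \<in> ?F \<or> (x, u) \<in> ?F \<and> ((u, w) \<in> ?F \<or> (x, w) \<in> ?F) \<or>
        (x, w) \<in> ?F \<and> (u, w) \<in> ?F" if x: "x \<in> ?V - S" for x
    proof (rule ccontr)
      assume "\<not> ?thesis"
      then have e: "(x, v) \<in> ?E"
        "(x, u) \<in> ?E \<and> (x, w) \<in> ?E \<or> (x, u) \<in> ?E \<and> (u, w) \<in> ?E \<or> (x, w) \<in> ?E \<and> (u, w) \<in> ?E"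
        using x uvw S by (auto simp: F)
      then have "linked ?E {x, u, w}"
        by (auto simp: linked_triple_iff[OF symE])
      then have "linked ?E (insert v {x, u, w})"
        using e(1) by (rule linked_insert[OF _ symE insertI1])
      moreover have "insert v {x, u, w} = insert x S" using uvw by auto
      ultimately show False using S(4)[OF x] by simp
    qed
    show "(\<exists>H. triple_star n H \<and> subgraph (with_proj H) (with_proj ?G')) \<or>
      (\<exists>H. type_H2 n H \<and> subgraph (with_proj H) (with_proj ?G'))"
    proof (cases "(u, w) \<in> ?F")
      case True
      \<comment> \<open>\<open>G\<close> is connected and \<open>S\<close> is not, so a further
        vertex exists; it provides the leaf that a triple-star must have.\<close>
      have "S \<noteq> ?V" using S V by auto
      then have "{u, v, w} \<subset> pverts ?G'" using S(1) uvw(1) V' by auto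
      moreover have "(u, x) \<in> ?F \<or> (v, x) \<in> ?F \<or> (w, x) \<in> ?F"
        if "x \<in> pverts ?G' - {u, v, w}" for x
        using near[of x] that uvw(1) V' F_comm by metis
      ultimately have
        "\<exists>H. triple_star (card (pverts ?G')) H \<and> subgraph (with_proj H) (with_proj ?G')"
        using spanning_triple_star[OF G'.pair_graph uvw(2) _ Fs True] by blast
      then show ?thesis using assms(3) V' by simp
    next
      case False
      let ?X = "?V - S"
      have "{y \<in> {u, v, w}. (x, y) \<in> ?F} \<in> {{u, v, w}, {u, v}, {v, w}, {u, w}, {v}}"
        if "x \<in> ?X" for x
      proof -
        have "{y \<in> {u, v, w}. (x, y) \<in> ?F} = (if (x, u) \<in> ?F then {u} else {}) \<union>
            (if (x, v) \<in> ?F then {v} else {}) \<union> (if (x, w) \<in> ?F then {w} else {})"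
          by auto
        \<comment> \<open>Without \<open>uw\<close> in the complement, two pairs out of
          \<open>xu\<close>, \<open>xw\<close>, \<open>uw\<close> can only be the first two.\<close>
        moreover have "(x, v) \<in> ?F \<or> (x, u) \<in> ?F \<and> (x, w) \<in> ?F"
          using near[OF that] False by blast
        ultimately show ?thesis
          by (cases "(x, u) \<in> ?F"; cases "(x, v) \<in> ?F"; cases "(x, w) \<in> ?F")
            (simp_all add: insert_commute)
      qed
      then have nbs: "\<forall>x\<in>?X. {y \<in> {u, v, w}. (x, y) \<in> ?F} \<in>
          {{u, v, w}, {u, v}, {v, w}, {u, w}, {v}}" by blast
      have "card ?X + 3 = n"
        using S assms(3) card_mono[OF pair_finite_verts S(1)] finite_subset[OF S(1) pair_finite_verts]
        by (simp add: card_Diff_subset)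
      moreover have "{u, v, w} \<inter> ?X = {}" "pverts ?G' = {u, v, w} \<union> ?X"
        using uvw(1) S(1) V' by auto
      ultimately have "distinct [u, v, w] \<and> {u, v, w} \<inter> ?X = {} \<and> card ?X + 3 = n \<and>
          pverts ?G' = {u, v, w} \<union> ?X \<and> (u, v) \<in> ?F \<and> (v, w) \<in> ?F \<and>
          (\<forall>x\<in>?X. {y \<in> {u, v, w}. (x, y) \<in> ?F} \<in> {{u, v, w}, {u, v}, {v, w}, {u, w}, {v}})"
        using uvw(2) Fs nbs by (intro conjI)
      \<comment> \<open>The whole complement is the witness, because \<open>type_H2\<close> leaves
        the adjacencies inside \<open>X\<close> free.\<close>
      then have "type_H2 n ?G'"
        unfolding type_H2_def by (intro conjI[OF G'.pair_graph] exI)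
      moreover have "subgraph (with_proj ?G') (with_proj ?G')"
        using G'.wf_digraph_axioms by (simp add: subgraph_def compatible_def)
      ultimately show ?thesis by blast
    qed
  next
    assume "(\<exists>H. triple_star n H \<and> subgraph (with_proj H) (with_proj ?G')) \<or>
      (\<exists>H. type_H2 n H \<and> subgraph (with_proj H) (with_proj ?G'))"
    then show "\<exists>S. blocked S"
    proof (elim disjE exE conjE)
      fix H assume H: "triple_star n H" "subgraph (with_proj H) (with_proj ?G')"
      from H(1) obtain u v w A B C where
        uvw: "distinct [u, v, w]" and fin: "finite A" "finite B" "finite C"
        and disj: "{u, v, w} \<inter> (A \<union> B \<union> C) = {}" "A \<inter> B = {}" "A \<inter> C = {}" "B \<inter> C = {}"
        and card: "card A + card B + card C + 3 = n"
        and verts: "pverts H = {u, v, w} \<union> A \<union> B \<union> C"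
        and arcs_eq: "parcs H = {(u, v), (v, w), (u, w)} \<union> {u} \<times> A \<union> {v} \<times> B \<union> {w} \<times> C \<union>
          ({(u, v), (v, w), (u, w)} \<union> {u} \<times> A \<union> {v} \<times> B \<union> {w} \<times> C)\<inverse>"
        unfolding triple_star_def Let_def
        by (elim exE conjE) (rule that)
      have arcs: "{(u, v), (v, w), (u, w)} \<union> {u} \<times> A \<union> {v} \<times> B \<union> {w} \<times> C \<subseteq> parcs H"
        unfolding arcs_eq by (rule Un_upper1)
      have sub: "pverts H \<subseteq> ?V" "parcs H \<subseteq> ?F"
        using H(2) V' by (auto simp: subgraph_def)
      have "card (A \<union> B \<union> C) = card A + card B + card C"
        using fin disj by (simp add: card_Un_disjoint Int_Un_distrib2)
      moreover have "pverts H = {u, v, w} \<union> (A \<union> B \<union> C)" using verts by blast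
      moreover have "card ({u, v, w} \<union> (A \<union> B \<union> C)) = card {u, v, w} + card (A \<union> B \<union> C)"
        by (rule card_Un_disjoint) (use fin disj(1) in auto)
      ultimately have "card (pverts H) = n"
        using uvw card by simp
      \<comment> \<open>A subgraph with \<open>n\<close> vertices spans, so every vertex off the
        triangle is a leaf of one of the stars.\<close>
      then have V_eq: "?V = {u, v, w} \<union> A \<union> B \<union> C"
        using card_subset_eq[OF pair_finite_verts sub(1)] assms(3) verts by simp
      have nE: "(u, v) \<notin> ?E" "(v, w) \<notin> ?E" "(u, w) \<notin> ?E"
        "\<And>x. x \<in> A \<Longrightarrow> (u, x) \<notin> ?E" "\<And>x. x \<in> B \<Longrightarrow> (v, x) \<notin> ?E"
        "\<And>x. x \<in> C \<Longrightarrow> (w, x) \<notin> ?E"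
        using arcs sub(2) F by blast+
      have "\<not> linked ?E (insert x {u, v, w})" if x: "x \<in> ?V - {u, v, w}" for x
      proof -
        \<comment> \<open>\<open>y\<close> is the centre at which \<open>x\<close> is a leaf. In
          \<open>G\<close> it misses \<open>x\<close> and both other centres, so no edge crosses the
          cut \<open>{y}\<close>.\<close>
        obtain y where "y \<in> {u, v, w}" "(y, x) \<notin> ?E"
          using x V_eq nE by blast
        then show ?thesis
          using nE E_comm x uvw by (intro not_linked[of "{y}"]) auto
      qed
      moreover have "\<not> linked ?E {u, v, w}"
        using nE uvw by (auto simp: linked_triple_iff[OF symE])
      ultimately have "blocked {u, v, w}" using V_eq uvw by (auto simp: blocked_def)
      then show ?thesis by blast
    next
      fix H assume H: "type_H2 n H" "subgraph (with_proj H) (with_proj ?G')"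
      from H(1) obtain u v w X where
        uvw: "distinct [u, v, w]" and disj: "{u, v, w} \<inter> X = {}"
        and card: "card X + 3 = n" and verts: "pverts H = {u, v, w} \<union> X"
        and arcs: "(u, v) \<in> parcs H" "(v, w) \<in> parcs H"
        and nbs: "\<forall>x\<in>X. {y \<in> {u, v, w}. (x, y) \<in> parcs H} \<in>
          {{u, v, w}, {u, v}, {v, w}, {u, w}, {v}}"
        unfolding type_H2_def by (elim exE conjE) (rule that)
      have sub: "pverts H \<subseteq> ?V" "parcs H \<subseteq> ?F"
        using H(2) V' by (auto simp: subgraph_def)
      have "finite X" using sub(1) verts finite_subset[OF _ pair_finite_verts] by auto
      then have "card (pverts H) = n"
        unfolding verts using disj uvw card by (subst card_Un_disjoint) auto
      then have V_eq: "?V = {u, v, w} \<union> X"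
        using card_subset_eq[OF pair_finite_verts sub(1)] assms(3) verts by simp
      have nE: "(u, v) \<notin> ?E" "(v, w) \<notin> ?E" using arcs sub(2) F by blast+
      have "\<not> linked ?E (insert x {u, v, w})" if x: "x \<in> ?V - {u, v, w}" for x
      proof -
        have "{y \<in> {u, v, w}. (x, y) \<in> parcs H} \<in> {{u, v, w}, {u, v}, {v, w}, {u, w}, {v}}"
          using nbs x V_eq by blast
        \<comment> \<open>The allowed neighbourhoods are exactly those containing \<open>v\<close>
          or both \<open>u\<close> and \<open>w\<close>.\<close>
        then have "v \<in> {y \<in> {u, v, w}. (x, y) \<in> parcs H} \<or>
            {u, w} \<subseteq> {y \<in> {u, v, w}. (x, y) \<in> parcs H}" by blast
        then have "(x, v) \<in> ?F \<or> (x, u) \<in> ?F \<and> (x, w) \<in> ?F" using sub(2) by blast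
        \<comment> \<open>In the first case \<open>v\<close> is isolated in the four-vertex set. In
          the second no edge of \<open>G\<close> joins \<open>{u, w}\<close> to
          \<open>{v, x}\<close>, even if \<open>uw\<close> and \<open>vx\<close> are edges.\<close>
        then consider "(x, v) \<notin> ?E" | "(x, u) \<notin> ?E" "(x, w) \<notin> ?E" by (auto simp: F)
        then show ?thesis
        proof cases
          case 1
          then show ?thesis
            using nE E_comm x uvw by (intro not_linked[of "{v}"]) auto
        next
          case 2
          then show ?thesis
            using nE E_comm x uvw by (intro not_linked[of "{u, w}"]) auto
        qed
      qed
      moreover have "\<not> linked ?E {u, v, w}"
        using nE uvw by (auto simp: linked_triple_iff[OF symE])
      ultimately have "blocked {u, v, w}" using V_eq uvw by (auto simp: blocked_def)
      then show ?thesis by blast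
    qed
  qed
  ultimately show ?thesis using le3 by blast
qed

end
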